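(* Fix a nonnegative integer $r$. Then there is a polynomial $p$ such that $St(k+r,k)=p(k)$ for all integers $k\ge0$. Furthermore, suppose that for $k\ge1$, \[ R(k)=\sum_{i=2}^{r+1}St\big((k+r)-i,\,k-1\big)\,St(i-1,0)=b_{n-1}k^{n-1}+\cdots+b_1k+b_0 . \] Then $p(k)=a_nk^n+\cdots+a_1k+a_0$ is a polynomial of degree $n$ whose coefficients are given by \[ a_n=\frac{b_{n-1}}{n},\qquad a_{n-j}=\frac{b_{n-j-1}-\sum_{i=0}^{j-1}(-1)^{j-i}\binom{n-i}{j+1-i}a_{n-i}}{\binom{n-j}{1}}\quad(1\le j\le n-1), \] and $a_0=St(r,0)$.
   Context: A strong fixed point of a permutation $\pi$ of $[n]$ is an element $k$ such that $\pi^{-1}(j)<\pi^{-1}(k)$ for all $j<k$ and $\pi^{-1}(i)>\pi^{-1}(k)$ for all $i>k$. $St(n,k)$ denotes the number of permutations of $[n]$ with exactly $k$ strong fixed points (with $St(0,0)=1$). *)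

theory Defs
  imports
    Complex_Main
    "HOL-Combinatorics.Permutations"
    "HOL-Computational_Algebra.Polynomial"
begin

text \<open>A permutation of $[n]$ is a function with \<^term>\<open>\<pi> permutes {1..n}\<close>; \<^term>\<open>inv \<pi> k\<close> is then
  the position of the value \<open>k\<close> in the one-line notation of \<open>\<pi>\<close>.\<close>

definition strong_fixed_point :: "nat \<Rightarrow> (nat \<Rightarrow> nat) \<Rightarrow> nat \<Rightarrow> bool" where
  "strong_fixed_point n \<pi> k \<longleftrightarrow> k \<in> {1..n} \<and>
     (\<forall>j\<in>{1..n}. j < k \<longrightarrow> inv \<pi> j < inv \<pi> k) \<and>
     (\<forall>i\<in>{1..n}. i > k \<longrightarrow> inv \<pi> i > inv \<pi> k)"

definition St :: "nat \<Rightarrow> nat \<Rightarrow> nat" where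
  "St n k = card {\<pi>. \<pi> permutes {1..n} \<and> card {m. strong_fixed_point n \<pi> m} = k}"

lemma St_0_0: "St 0 0 = 1"
  by (simp add: St_def strong_fixed_point_def)

end

theory Submission
  imports Defs
begin

text \<open>
  A strong fixed point \<open>i\<close> of a permutation \<open>\<pi>\<close> of \<open>[n]\<close> splits \<open>\<pi>\<close> into a permutation of
  \<open>[i - 1]\<close> and a shifted permutation of \<open>[n - i]\<close>. Splitting at the smallest strong fixed point
  gives \<open>St(n, k + 1) = \<Sum>\<^sub>i St(i - 1, 0) St(n - i, k)\<close>. For \<open>n = k + r\<close> the summand \<open>i = 1\<close> of
  \<open>St(k + r, k)\<close> is \<open>St((k - 1) + r, k - 1)\<close>, so \<open>k \<mapsto> St(k + r, k)\<close> has backward difference \<open>R\<close>,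
  which by induction on \<open>r\<close> is a polynomial. Comparing coefficients in
  \<open>p(x) - p(x - 1) = R(x)\<close> yields the recursion for the \<open>a\<^sub>i\<close>.
\<close>

subsection \<open>Splitting at the smallest strong fixed point\<close>

text \<open>Forward, two counts pin down the position of \<open>k\<close>: all values below
  \<open>k\<close> stand to its left, so its position is at least \<open>k\<close>; the positions up
  to and including its own carry only values up to \<open>k\<close>, so its position is at most
  \<open>k\<close>. A criterion without \<open>inv\<close> can be checked directly on glued
  permutations.\<close>

lemma strong_fixed_point_iff:
  assumes "\<pi> permutes {1..n}"
  shows "strong_fixed_point n \<pi> k \<longleftrightarrow> k \<in> {1..n} \<and> \<pi> k = k \<and> (\<forall>j<k. \<pi> j < k)"
proof
  let ?\<sigma> = "inv \<pi>"
  have \<sigma>: "?\<sigma> permutes {1..n}" by (rule permutes_inv[OF assms])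
  have inv1: "\<pi> (?\<sigma> x) = x" and inv2: "?\<sigma> (\<pi> x) = x" for x
    using permutes_inverses[OF assms] by auto
  assume s: "strong_fixed_point n \<pi> k"
  then have k: "k \<in> {1..n}" by (simp add: strong_fixed_point_def)
  then have \<sigma>k: "?\<sigma> k \<in> {1..n}" using permutes_in_image[OF \<sigma>] by blast
  \<comment> \<open>The value 0 lies outside \<open>{1..n}\<close> and is fixed; including it gives
    the count over \<open>{..<k}\<close> exactly \<open>k\<close> elements.\<close>
  have less: "?\<sigma> j < ?\<sigma> k" if "j < k" for j
  proof (cases "j = 0")
    case True
    then have "?\<sigma> j = 0" using permutes_not_in[OF \<sigma>] by simp
    then show ?thesis using \<sigma>k by simp
  next
    case False
    then show ?thesis using s that k by (simp add: strong_fixed_point_def)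
  qed
  have gr: "?\<sigma> k < ?\<sigma> i" if "k < i" for i
  proof (cases "i \<le> n")
    case False
    then have "?\<sigma> i = i" using permutes_not_in[OF \<sigma>] by simp
    then show ?thesis using \<sigma>k False by simp
  next
    case True
    then show ?thesis using s that k by (simp add: strong_fixed_point_def)
  qed
  have "card (?\<sigma> ` {..<k}) \<le> card {..<?\<sigma> k}"
    by (rule card_mono) (use less in auto)
  then have le: "k \<le> ?\<sigma> k" by (simp add: card_image permutes_inj_on[OF \<sigma>])
  have "card (\<pi> ` {..?\<sigma> k}) \<le> card {..k}"
  proof (rule card_mono)
    show "\<pi> ` {..?\<sigma> k} \<subseteq> {..k}"
      using gr inv2 by (metis atMost_iff image_subsetI leD leI)
  qed simp
  then have "?\<sigma> k = k" using le by (simp add: card_image permutes_inj_on[OF assms])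
  moreover have "\<pi> j < k" if "j < k" for j
  proof (rule ccontr)
    assume "\<not> \<pi> j < k"
    then have "\<pi> j = k \<or> k < \<pi> j" by auto
    then show False using gr[of "\<pi> j"] that \<open>?\<sigma> k = k\<close> inv2[of j] by auto
  qed
  ultimately show "k \<in> {1..n} \<and> \<pi> k = k \<and> (\<forall>j<k. \<pi> j < k)"
    using k inv1[of k] by auto
next
  let ?\<sigma> = "inv \<pi>"
  have inv1: "\<pi> (?\<sigma> x) = x" and inv2: "?\<sigma> (\<pi> x) = x" for x
    using permutes_inverses[OF assms] by auto
  assume a: "k \<in> {1..n} \<and> \<pi> k = k \<and> (\<forall>j<k. \<pi> j < k)"
  have \<sigma>k: "?\<sigma> k = k" using a inv2[of k] by simp
  \<comment> \<open>An injective self-map of a finite set is onto, so the inverse preserves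
    \<open>{..<k}\<close> as well.\<close>
  have "\<pi> ` {..<k} = {..<k}"
    by (rule endo_inj_surj) (use a permutes_inj_on[OF assms] in auto)
  then have less: "?\<sigma> j < k" if "j < k" for j
    using that inv2 by (metis imageE lessThan_iff)
  have gr: "k < ?\<sigma> i" if "k < i" for i
    using that a inv1[of i] by (metis linorder_less_linear not_less_iff_gr_or_eq)
  show "strong_fixed_point n \<pi> k"
    using a less gr by (simp add: strong_fixed_point_def \<sigma>k)
qed

section \<open>Gluing two permutations around a strong fixed point\<close>

text \<open>The fixed point \<open>i\<close> itself falls under the second branch: a permutation
  \<open>\<beta>\<close> of \<open>{1..n - i}\<close> fixes 0, so \<open>i\<close> is sent to
  \<open>i\<close>.\<close>

definition join :: "nat \<Rightarrow> (nat \<Rightarrow> nat) \<Rightarrow> (nat \<Rightarrow> nat) \<Rightarrow> nat \<Rightarrow> nat" where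
  "join i \<alpha> \<beta> m = (if m < i then \<alpha> m else \<beta> (m - i) + i)"

definition sfp_perms :: "nat \<Rightarrow> nat \<Rightarrow> (nat \<Rightarrow> nat) set" where
  "sfp_perms n k = {\<pi>. \<pi> permutes {1..n} \<and> card {m. strong_fixed_point n \<pi> m} = k}"

lemma finite_sfp_perms: "finite (sfp_perms n k)"
  unfolding sfp_perms_def by (rule finite_subset[OF _ finite_permutations[of "{1..n}"]]) auto

lemma finite_strong_fixed_points: "finite {m. strong_fixed_point n \<pi> m}"
  by (rule finite_subset[of _ "{1..n}"]) (auto simp: strong_fixed_point_def)

lemma sfp_perms_0_iff:
  "\<pi> \<in> sfp_perms n 0 \<longleftrightarrow> \<pi> permutes {1..n} \<and> (\<forall>m. \<not> strong_fixed_point n \<pi> m)"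
  using finite_strong_fixed_points[of n \<pi>] by (auto simp: sfp_perms_def)

lemma permutes_0: "\<pi> permutes {1..n} \<Longrightarrow> \<pi> 0 = (0::nat)"
  by (rule permutes_not_in) auto

lemma join_permutes:
  assumes \<alpha>: "\<alpha> permutes {1..i - 1}" and \<beta>: "\<beta> permutes {1..n - i}" and i: "i \<in> {1..n}"
  shows "join i \<alpha> \<beta> permutes {1..n}"
proof (rule inj_imp_permutes)
  have lt: "\<alpha> m < i" if "m < i" for m
    using permutes_in_image[OF \<alpha>, of m] permutes_0[OF \<alpha>] that i by (cases "m = 0") auto
  have in\<alpha>: "\<alpha> m \<ge> 1" if "1 \<le> m" "m < i" for m
    using permutes_in_image[OF \<alpha>, of m] that by auto
  \<comment> \<open>The case \<open>m = 0\<close> is included because \<open>join\<close> evaluates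
    \<open>\<beta>\<close> at 0 for the argument \<open>i\<close>.\<close>
  have in\<beta>: "\<beta> m \<le> n - i" if "m \<le> n - i" for m
    using permutes_in_image[OF \<beta>, of m] permutes_0[OF \<beta>] that by (cases "m = 0") auto
  show "inj_on (join i \<alpha> \<beta>) {1..n}"
  proof (rule inj_onI)
    fix x y assume e: "join i \<alpha> \<beta> x = join i \<alpha> \<beta> y"
    show "x = y"
      using e lt[of x] lt[of y] injD[OF permutes_inj[OF \<alpha>], of x y]
        injD[OF permutes_inj[OF \<beta>], of "x - i" "y - i"]
      by (auto simp: join_def split: if_splits)
  qed
  show "join i \<alpha> \<beta> x \<in> {1..n}" if x: "x \<in> {1..n}" for x
  proof (cases "x < i")
    case True
    then show ?thesis using lt[of x] in\<alpha>[of x] x i by (simp add: join_def)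
  next
    case False
    then have "\<beta> (x - i) \<le> n - i" using x by (intro in\<beta> diff_le_mono) auto
    then show ?thesis using False x i by (auto simp: join_def)
  qed
  show "join i \<alpha> \<beta> x = x" if x: "x \<notin> {1..n}" for x
  proof (cases "x = 0")
    case True
    then show ?thesis using permutes_0[OF \<alpha>] i by (simp add: join_def)
  next
    case False
    then have "x > n" using x by auto
    then have "\<beta> (x - i) = x - i" using i by (intro permutes_not_in[OF \<beta>]) auto
    then show ?thesis using \<open>x > n\<close> i by (simp add: join_def)
  qed
qed simp

text \<open>The criterion at \<open>m\<close> involves only arguments up to \<open>m\<close>. For
  \<open>m < i\<close> these see only \<open>\<alpha>\<close>; for larger \<open>m\<close> the
  arguments below \<open>i\<close> impose nothing, since \<open>\<alpha>\<close> keeps them below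
  \<open>i\<close>, and the others form a shifted copy of \<open>\<beta>\<close>. The case
  \<open>m = i\<close> is listed separately because 0 never counts as a strong fixed point of
  \<open>\<beta>\<close>.\<close>

lemma strong_fixed_point_join:
  assumes \<alpha>: "\<alpha> permutes {1..i - 1}" and \<beta>: "\<beta> permutes {1..n - i}" and i: "i \<in> {1..n}"
  shows "strong_fixed_point n (join i \<alpha> \<beta>) m \<longleftrightarrow>
    (if m < i then strong_fixed_point (i - 1) \<alpha> m
     else m = i \<or> strong_fixed_point (n - i) \<beta> (m - i))"
proof -
  have lt: "\<alpha> m < i" if "m < i" for m
    using permutes_in_image[OF \<alpha>, of m] permutes_0[OF \<alpha>] that i by (cases "m = 0") auto
  note iffs = strong_fixed_point_iff[OF join_permutes[OF assms]]
    strong_fixed_point_iff[OF \<alpha>] strong_fixed_point_iff[OF \<beta>]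
  show ?thesis
  proof (cases "m < i")
    case True
    then show ?thesis using i by (auto simp: iffs join_def simp del: One_nat_def)
  next
    case False
    have "(\<forall>j<m. join i \<alpha> \<beta> j < m) \<longleftrightarrow> (\<forall>j<m - i. \<beta> j < m - i)"
    proof
      assume a: "\<forall>j<m. join i \<alpha> \<beta> j < m"
      show "\<forall>j<m - i. \<beta> j < m - i"
      proof (intro allI impI)
        fix j assume "j < m - i"
        then have "j + i < m" by simp
        then show "\<beta> j < m - i" using a[rule_format, of "j + i"] by (simp add: join_def)
      qed
    next
      assume a: "\<forall>j<m - i. \<beta> j < m - i"
      show "\<forall>j<m. join i \<alpha> \<beta> j < m"
      proof (intro allI impI)
        fix j assume "j < m"
        show "join i \<alpha> \<beta> j < m"
        proof (cases "j < i")
          case True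
          then show ?thesis using lt[of j] False by (simp add: join_def)
        next
          case False
          then have "j - i < m - i" using \<open>j < m\<close> by simp
          then show ?thesis using a[rule_format, of "j - i"] False by (simp add: join_def)
        qed
      qed
    qed
    then show ?thesis
      using False i permutes_0[OF \<beta>] by (auto simp: iffs join_def)
  qed
qed

text \<open>\<open>\<alpha>\<close> contributes nothing, so what remains is \<open>i\<close>
  together with the strong fixed points of \<open>\<beta>\<close> shifted by
  \<open>i\<close>.\<close>

lemma card_strong_fixed_points_join:
  assumes \<alpha>: "\<alpha> \<in> sfp_perms (i - 1) 0" and \<beta>: "\<beta> \<in> sfp_perms (n - i) k" and i: "i \<in> {1..n}"
  shows "card {m. strong_fixed_point n (join i \<alpha> \<beta>) m} = Suc k"
proof -
  let ?B = "{m. strong_fixed_point (n - i) \<beta> m}"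
  have perm: "\<alpha> permutes {1..i - 1}" "\<beta> permutes {1..n - i}"
    using \<alpha> \<beta> by (auto simp: sfp_perms_def)
  have "{m. strong_fixed_point n (join i \<alpha> \<beta>) m} = insert i ((\<lambda>m. m + i) ` ?B)"
  proof (intro set_eqI iffI)
    fix m assume "m \<in> {m. strong_fixed_point n (join i \<alpha> \<beta>) m}"
    then have "m \<ge> i \<and> (m = i \<or> strong_fixed_point (n - i) \<beta> (m - i))"
      using \<alpha> by (auto simp: strong_fixed_point_join[OF perm i] sfp_perms_0_iff split: if_splits)
    then have "m = i \<or> (m = m - i + i \<and> m - i \<in> ?B)" by auto
    then show "m \<in> insert i ((\<lambda>m. m + i) ` ?B)" by blast
  qed (auto simp: strong_fixed_point_join[OF perm i])
  moreover have "i \<notin> (\<lambda>m. m + i) ` ?B" by (auto simp: strong_fixed_point_def)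
  moreover have "card ((\<lambda>m. m + i) ` ?B) = k"
    using \<beta> by (subst card_image) (auto simp: sfp_perms_def)
  ultimately show ?thesis using finite_strong_fixed_points[of "n - i" \<beta>] by simp
qed

section \<open>Existence and uniqueness of the decomposition\<close>

text \<open>The cut is made at the least strong fixed point; its minimality is what leaves the left
  part without strong fixed points.\<close>

lemma join_surj:
  assumes \<pi>: "\<pi> \<in> sfp_perms n (Suc k)"
  obtains i \<alpha> \<beta> where "i \<in> {1..n}" "\<alpha> \<in> sfp_perms (i - 1) 0" "\<beta> \<in> sfp_perms (n - i) k"
    "\<pi> = join i \<alpha> \<beta>"
proof -
  define i where "i = (LEAST m. strong_fixed_point n \<pi> m)"
  \<comment> \<open>The left part must be the identity from \<open>i\<close> on to be a permutation
    of \<open>{1..i - 1}\<close>. In the right part the truncated subtraction loses nothing, since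
    \<open>\<pi>\<close> never maps an argument from \<open>i\<close> on below
    \<open>i\<close>.\<close>
  define \<alpha> where "\<alpha> m = (if m < i then \<pi> m else m)" for m
  define \<beta> where "\<beta> m = \<pi> (m + i) - i" for m
  have perm: "\<pi> permutes {1..n}" and card: "card {m. strong_fixed_point n \<pi> m} = Suc k"
    using \<pi> by (auto simp: sfp_perms_def)
  then have "{m. strong_fixed_point n \<pi> m} \<noteq> {}" by force
  then have sfp: "strong_fixed_point n \<pi> i" unfolding i_def by (auto intro: LeastI)
  then have i: "i \<in> {1..n}" and \<pi>i: "\<pi> i = i"
    by (auto simp: strong_fixed_point_iff[OF perm])
  have lt: "\<pi> j < i" if "j < i" for j
    using sfp that by (simp add: strong_fixed_point_iff[OF perm])
  \<comment> \<open>All values below \<open>i\<close> are already taken by arguments below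
    \<open>i\<close>, so injectivity forces the remaining arguments to values from \<open>i\<close>
    on.\<close>
  have "\<pi> ` {..<i} = {..<i}"
    by (rule endo_inj_surj) (use lt permutes_inj_on[OF perm] in auto)
  then have ge: "i \<le> \<pi> m" if "i \<le> m" for m
    using that injD[OF permutes_inj[OF perm], of m] by (metis imageE leD leI lessThan_iff)
  have \<alpha>: "\<alpha> permutes {1..i - 1}"
  proof (rule inj_imp_permutes)
    show "inj_on \<alpha> {1..i - 1}"
      using injD[OF permutes_inj[OF perm]] i by (auto simp: \<alpha>_def inj_on_def)
    show "\<alpha> x \<in> {1..i - 1}" if "x \<in> {1..i - 1}" for x
      using that lt[of x] permutes_in_image[OF perm, of x] i by (auto simp: \<alpha>_def)
    show "\<alpha> x = x" if "x \<notin> {1..i - 1}" for x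
      using that permutes_0[OF perm] i by (cases "x = 0") (auto simp: \<alpha>_def)
  qed simp
  have \<beta>: "\<beta> permutes {1..n - i}"
  proof (rule inj_imp_permutes)
    show "inj_on \<beta> {1..n - i}"
    proof (rule inj_onI)
      fix x y assume "\<beta> x = \<beta> y"
      then have "\<pi> (x + i) = \<pi> (y + i)" using ge[of "x + i"] ge[of "y + i"] by (simp add: \<beta>_def)
      then show "x = y" using injD[OF permutes_inj[OF perm]] by fastforce
    qed
    show "\<beta> x \<in> {1..n - i}" if x: "x \<in> {1..n - i}" for x
    proof -
      have "\<pi> (x + i) \<noteq> \<pi> i" using injD[OF permutes_inj[OF perm], of "x + i" i] x by auto
      then show ?thesis
        using x ge[of "x + i"] permutes_in_image[OF perm, of "x + i"] i \<pi>i by (auto simp: \<beta>_def)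
    qed
    show "\<beta> x = x" if "x \<notin> {1..n - i}" for x
      using that permutes_not_in[OF perm, of "x + i"] \<pi>i by (cases "x = 0") (auto simp: \<beta>_def)
  qed simp
  have eq: "\<pi> = join i \<alpha> \<beta>"
    using ge by (auto simp: fun_eq_iff join_def \<alpha>_def \<beta>_def)
  have \<alpha>0: "\<alpha> \<in> sfp_perms (i - 1) 0"
  proof -
    have "\<not> strong_fixed_point (i - 1) \<alpha> m" for m
    proof
      assume a: "strong_fixed_point (i - 1) \<alpha> m"
      then have "m < i" by (auto simp: strong_fixed_point_def)
      moreover from this a have "strong_fixed_point n \<pi> m"
        unfolding eq strong_fixed_point_join[OF \<alpha> \<beta> i] by simp
      ultimately show False unfolding i_def using not_less_Least by blast
    qed
    then show ?thesis using \<alpha> by (simp add: sfp_perms_0_iff)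
  qed
  \<comment> \<open>The number of strong fixed points of \<open>\<beta>\<close> is left open at
    first; counting those of the join then identifies it as \<open>k\<close>.\<close>
  have "\<beta> \<in> sfp_perms (n - i) (card {m. strong_fixed_point (n - i) \<beta> m})"
    using \<beta> by (simp add: sfp_perms_def)
  then have "\<beta> \<in> sfp_perms (n - i) k"
    using card_strong_fixed_points_join[OF \<alpha>0 _ i] card eq by force
  then show thesis using that i \<alpha>0 eq by blast
qed

text \<open>The first join has \<open>i\<close> as a strong fixed point, while the second has none
  below \<open>i'\<close> because \<open>\<alpha>'\<close> has none. Used in both directions, this
  makes the classes for different cut points disjoint.\<close>

lemma join_index_unique:
  assumes \<alpha>: "\<alpha> permutes {1..i - 1}" and \<beta>: "\<beta> permutes {1..n - i}" and i: "i \<in> {1..n}"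
    and \<alpha>': "\<alpha>' \<in> sfp_perms (i' - 1) 0" and \<beta>': "\<beta>' permutes {1..n - i'}" and i': "i' \<in> {1..n}"
    and eq: "join i \<alpha> \<beta> = join i' \<alpha>' \<beta>'"
  shows "i' \<le> i"
proof (rule ccontr)
  assume "\<not> i' \<le> i"
  moreover have "strong_fixed_point n (join i' \<alpha>' \<beta>') i"
    using strong_fixed_point_join[OF \<alpha> \<beta> i, of i] eq by simp
  ultimately show False
    using strong_fixed_point_join[OF _ \<beta>' i', of \<alpha>' i] \<alpha>' by (simp add: sfp_perms_0_iff)
qed

lemma inj_on_join:
  assumes i: "i \<in> {1..n}"
  shows "inj_on (\<lambda>(\<alpha>, \<beta>). join i \<alpha> \<beta>) (sfp_perms (i - 1) 0 \<times> B)"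
proof (rule inj_onI, clarify)
  fix \<alpha> \<beta> \<alpha>' \<beta>'
  assume "\<alpha> \<in> sfp_perms (i - 1) 0" "\<alpha>' \<in> sfp_perms (i - 1) 0" and eq: "join i \<alpha> \<beta> = join i \<alpha>' \<beta>'"
  then have "\<alpha> permutes {1..i - 1}" "\<alpha>' permutes {1..i - 1}" by (auto simp: sfp_perms_def)
  \<comment> \<open>A join does not record its left part from \<open>i\<close> on, but there both
    candidates are the identity.\<close>
  then have out: "\<alpha> m = m" "\<alpha>' m = m" if "m \<ge> i" for m
    using that i by (auto intro!: permutes_not_in)
  have "\<alpha> m = \<alpha>' m" for m
    using out[of m] fun_cong[OF eq, of m] by (cases "m < i") (auto simp: join_def)
  moreover have "\<beta> m = \<beta>' m" for m
    using fun_cong[OF eq, of "m + i"] by (simp add: join_def)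
  ultimately show "\<alpha> = \<alpha>' \<and> \<beta> = \<beta>'" by auto
qed

section \<open>The recurrence for \<open>St\<close>\<close>

text \<open>The sets \<open>J i\<close> partition the permutations by their smallest strong fixed
  point \<open>i\<close>, and gluing is a bijection from pairs onto each of them.\<close>

lemma St_Suc: "St n (Suc k) = (\<Sum>i=1..n. St (i - 1) 0 * St (n - i) k)"
proof -
  define J where "J i = (\<lambda>(\<alpha>, \<beta>). join i \<alpha> \<beta>) ` (sfp_perms (i - 1) 0 \<times> sfp_perms (n - i) k)" for i
  have "sfp_perms n (Suc k) = (\<Union>i\<in>{1..n}. J i)"
  proof (intro set_eqI iffI)
    fix \<pi> assume "\<pi> \<in> sfp_perms n (Suc k)"
    then show "\<pi> \<in> (\<Union>i\<in>{1..n}. J i)" by (elim join_surj) (auto simp: J_def)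
  next
    fix \<pi> assume "\<pi> \<in> (\<Union>i\<in>{1..n}. J i)"
    then obtain i \<alpha> \<beta> where *: "i \<in> {1..n}" "\<alpha> \<in> sfp_perms (i - 1) 0" "\<beta> \<in> sfp_perms (n - i) k"
      "\<pi> = join i \<alpha> \<beta>" by (auto simp: J_def)
    then show "\<pi> \<in> sfp_perms n (Suc k)"
      using card_strong_fixed_points_join[OF *(2,3,1)] join_permutes[of \<alpha> i \<beta> n]
      by (simp add: sfp_perms_def)
  qed
  moreover have "card (\<Union>i\<in>{1..n}. J i) = (\<Sum>i=1..n. card (J i))"
  proof (rule card_UN_disjoint)
    show "\<forall>i\<in>{1..n}. finite (J i)" by (simp add: J_def finite_sfp_perms)
    show "\<forall>i\<in>{1..n}. \<forall>j\<in>{1..n}. i \<noteq> j \<longrightarrow> J i \<inter> J j = {}"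
    proof (intro ballI impI, rule ccontr)
      fix i j assume i: "i \<in> {1..n}" and j: "j \<in> {1..n}" and "i \<noteq> j" "J i \<inter> J j \<noteq> {}"
      then obtain \<alpha> \<beta> \<alpha>' \<beta>' where
        *: "\<alpha> \<in> sfp_perms (i - 1) 0" "\<beta> \<in> sfp_perms (n - i) k"
           "\<alpha>' \<in> sfp_perms (j - 1) 0" "\<beta>' \<in> sfp_perms (n - j) k" "join i \<alpha> \<beta> = join j \<alpha>' \<beta>'"
        by (fastforce simp: J_def)
      then have perm: "\<alpha> permutes {1..i - 1}" "\<beta> permutes {1..n - i}"
        "\<alpha>' permutes {1..j - 1}" "\<beta>' permutes {1..n - j}" by (auto simp: sfp_perms_def)
      have "i = j"
        using join_index_unique[OF perm(1,2) i *(3) perm(4) j *(5)]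
          join_index_unique[OF perm(3,4) j *(1) perm(2) i *(5)[symmetric]] by simp
      then show False using \<open>i \<noteq> j\<close> by simp
    qed
  qed simp
  moreover have "card (J i) = St (i - 1) 0 * St (n - i) k" if "i \<in> {1..n}" for i
    unfolding J_def using inj_on_join[OF that]
    by (simp add: card_image card_cartesian_product St_def sfp_perms_def)
  ultimately show ?thesis by (simp add: St_def sfp_perms_def)
qed

lemma St_eq_0:
  assumes "n < k"
  shows "St n k = 0"
proof -
  have "card {m. strong_fixed_point n \<pi> m} \<le> card {1..n}" for \<pi>
    by (rule card_mono) (auto simp: strong_fixed_point_def)
  then have "card {m. strong_fixed_point n \<pi> m} \<noteq> k" for \<pi>
    using assms by (metis card_atLeastAtMost diff_Suc_1 leD)
  then show ?thesis by (simp add: St_def)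
qed

text \<open>The summand \<open>i = 1\<close> has the factor \<open>St 0 0 = 1\<close> and stays on
  the same diagonal; splitting it off exhibits the rest, \<open>R(k + 1)\<close>, as an increment
  along that diagonal.\<close>

lemma St_add_Suc:
  "St (Suc k + r) (Suc k) =
    St (k + r) k + (\<Sum>i=2..r + 1. St (Suc k + r - i) k * St (i - 1) 0)"
proof -
  have "St (Suc k + r) (Suc k) = (\<Sum>i=1..Suc k + r. St (Suc k + r - i) k * St (i - 1) 0)"
    by (simp add: St_Suc mult.commute)
  \<comment> \<open>For \<open>i > r + 1\<close> the first argument of \<open>St\<close> drops below
    \<open>k\<close>, so these terms vanish.\<close>
  also have "\<dots> = (\<Sum>i=1..r + 1. St (Suc k + r - i) k * St (i - 1) 0)"
    by (rule sum.mono_neutral_right) (auto simp: St_eq_0)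
  also have "\<dots> = St (k + r) k + (\<Sum>i=2..r + 1. St (Suc k + r - i) k * St (i - 1) 0)"
    by (subst sum.atLeast_Suc_atMost) (simp_all add: St_0_0 numeral_2_eq_2)
  finally show ?thesis .
qed

subsection \<open>Sums and differences of polynomials\<close>

text \<open>The differences of \<open>j ^ Suc m\<close> telescope to \<open>k ^ Suc m\<close>.
  Expanding them binomially gives the sums of all powers up to \<open>m\<close>; the lower ones are
  polynomials by induction, and solving for the top one defines \<open>Q\<close>.\<close>

lemma sum_power_polynomial: "\<exists>P::real poly. \<forall>k. poly P (real k) = (\<Sum>j<k. real j ^ m)"
proof (induction m rule: less_induct)
  case (less m)
  then obtain P :: "nat \<Rightarrow> real poly" where
    P: "\<And>i k. i < m \<Longrightarrow> poly (P i) (real k) = (\<Sum>j<k. real j ^ i)" by metis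
  define Q where
    "Q = smult (1 / real (Suc m)) (monom 1 (Suc m) - (\<Sum>i<m. smult (real (Suc m choose i)) (P i)))"
  have "poly Q (real k) = (\<Sum>j<k. real j ^ m)" for k
  proof -
    have "real k ^ Suc m = (\<Sum>j<k. real (Suc j) ^ Suc m - real j ^ Suc m)"
      by (subst sum_lessThan_telescope) simp
    also have "\<dots> = (\<Sum>j<k. \<Sum>i\<le>m. real (Suc m choose i) * real j ^ i)"
    proof (rule sum.cong[OF refl])
      fix j
      have "real (Suc j) ^ Suc m = (\<Sum>i\<le>Suc m. real (Suc m choose i) * real j ^ i)"
        using binomial_ring[of "real j" 1 "Suc m"] by (simp add: add.commute)
      then show "real (Suc j) ^ Suc m - real j ^ Suc m = (\<Sum>i\<le>m. real (Suc m choose i) * real j ^ i)"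
        by simp
    qed
    also have "\<dots> = (\<Sum>i\<le>m. real (Suc m choose i) * (\<Sum>j<k. real j ^ i))"
      by (subst sum.swap) (simp add: sum_distrib_left)
    also have "\<dots> = (\<Sum>i<m. real (Suc m choose i) * poly (P i) (real k))
        + real (Suc m) * (\<Sum>j<k. real j ^ m)"
      by (simp add: P lessThan_Suc_atMost[symmetric] del: of_nat_Suc)
    finally have "real k ^ Suc m = (\<Sum>i<m. real (Suc m choose i) * poly (P i) (real k))
        + real (Suc m) * (\<Sum>j<k. real j ^ m)" .
    then show ?thesis
      by (simp add: Q_def poly_monom poly_sum divide_simps del: of_nat_Suc binomial_Suc_Suc power_Suc)
  qed
  then show ?case by blast
qed

lemma sum_poly_polynomial:
  fixes q :: "real poly"
  shows "\<exists>P::real poly. \<forall>k. poly P (real k) = (\<Sum>j<k. poly q (real j))"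
proof -
  obtain S :: "nat \<Rightarrow> real poly" where S: "\<And>m k. poly (S m) (real k) = (\<Sum>j<k. real j ^ m)"
    using sum_power_polynomial by metis
  have "poly (\<Sum>m\<le>degree q. smult (coeff q m) (S m)) (real k) = (\<Sum>j<k. poly q (real j))" for k
    by (subst poly_altdef[of q], subst sum.swap) (simp add: poly_sum S sum_distrib_left)
  then show ?thesis by blast
qed

section \<open>Backward differences and comparison of coefficients\<close>

text \<open>A nonzero difference would have infinitely many roots. The threshold \<open>K\<close> is
  there because the difference equation for \<open>R\<close> is given only for
  \<open>k \<ge> 1\<close>.\<close>

lemma poly_eqI_nat:
  fixes p q :: "real poly"
  assumes "\<And>k. k \<ge> K \<Longrightarrow> poly p (real k) = poly q (real k)"
  shows "p = q"
proof (rule ccontr)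
  assume "p \<noteq> q"
  then have "finite {x. poly (p - q) x = 0}" by (intro poly_roots_finite) simp
  then have "finite (real ` {K..})" by (rule finite_subset[rotated]) (use assms in auto)
  then show False by (simp add: finite_image_iff infinite_Ici)
qed

lemma pcompose_power: "pcompose (p ^ n) q = pcompose p q ^ n"
  for p q :: "'a::comm_semiring_1 poly"
  by (induction n) (simp_all add: pcompose_1 pcompose_mult)

text \<open>Substitution turns each monomial of degree \<open>l\<close> into a power of
  \<open>x + c\<close>, to which the binomial theorem applies; powers with \<open>l < m\<close> have
  no coefficient at \<open>m\<close>.\<close>

lemma coeff_pcompose_translate:
  fixes p :: "'a::comm_ring_1 poly"
  assumes "degree p \<le> N"
  shows "coeff (pcompose p [:c, 1:]) m = (\<Sum>l=m..N. coeff p l * of_nat (l choose m) * c ^ (l - m))"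
proof -
  have "pcompose p [:c, 1:] = pcompose (\<Sum>l\<le>N. monom (coeff p l) l) [:c, 1:]"
    using assms by (simp add: poly_as_sum_of_monoms')
  also have "\<dots> = (\<Sum>l\<le>N. smult (coeff p l) ([:c, 1:] ^ l))"
    by (simp add: pcompose_sum monom_altdef pcompose_smult pcompose_power pcompose_pCons)
  finally have "coeff (pcompose p [:c, 1:]) m = (\<Sum>l\<le>N. coeff p l * coeff ([:c, 1:] ^ l) m)"
    by (simp add: coeff_sum)
  also have "\<dots> = (\<Sum>l=m..N. coeff p l * coeff ([:c, 1:] ^ l) m)"
    by (rule sum.mono_neutral_right) (auto simp: not_le coeff_eq_0 degree_linear_power)
  also have "\<dots> = (\<Sum>l=m..N. coeff p l * of_nat (l choose m) * c ^ (l - m))"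
    by (rule sum.cong) (auto simp: coeff_linear_poly_power)
  finally show ?thesis .
qed

text \<open>The term \<open>l = m\<close> of the translated polynomial cancels against
  \<open>coeff p m\<close>; the minus sign in front of the others lowers the exponent of -1 by
  one.\<close>

lemma coeff_backward_difference:
  fixes p :: "'a::comm_ring_1 poly"
  assumes "degree p \<le> N"
  shows "coeff (p - pcompose p [:-1, 1:]) m =
    (\<Sum>l=Suc m..N. coeff p l * of_nat (l choose m) * (-1) ^ (l - Suc m))"
proof (cases "m \<le> N")
  case True
  have "(\<Sum>l=Suc m..N. coeff p l * of_nat (l choose m) * (-1) ^ (l - m)) =
      - (\<Sum>l=Suc m..N. coeff p l * of_nat (l choose m) * (-1) ^ (l - Suc m))"
    unfolding sum_negf[symmetric]
  proof (rule sum.cong[OF refl])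
    fix l assume "l \<in> {Suc m..N}"
    then have "l - m = Suc (l - Suc m)" by auto
    then show "coeff p l * of_nat (l choose m) * (-1) ^ (l - m) =
        - (coeff p l * of_nat (l choose m) * (-1) ^ (l - Suc m))" by simp
  qed
  then show ?thesis
    using True by (simp add: coeff_pcompose_translate[OF assms] sum.atLeast_Suc_atMost)
next
  case False
  then show ?thesis
    using assms by (simp add: coeff_pcompose_translate[OF assms] coeff_eq_0)
qed

lemma backward_difference_coeffs:
  fixes p :: "real poly" and b :: "nat \<Rightarrow> real"
  assumes n: "n \<ge> 1"
    and diff: "\<And>k. k \<ge> 1 \<Longrightarrow> poly p (real k) - poly p (real k - 1) = (\<Sum>m=0..n - 1. b m * real k ^ m)"
  shows "degree p \<le> n"
    and "m < n \<Longrightarrow> b m = (\<Sum>l=Suc m..n. coeff p l * real (l choose m) * (-1) ^ (l - Suc m))"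
proof -
  define q where "q = (\<Sum>m\<le>n - 1. monom (b m) m)"
  have "p - pcompose p [:-1, 1:] = q"
  proof (rule poly_eqI_nat[of 1])
    fix k :: nat assume "1 \<le> k"
    then show "poly (p - pcompose p [:-1, 1:]) (real k) = poly q (real k)"
      using diff[of k] by (simp add: q_def poly_pcompose poly_sum poly_monom atLeast0AtMost algebra_simps)
  qed
  moreover have coeff_q: "coeff q m = (if m < n then b m else 0)" for m
    using n by (auto simp: q_def coeff_sum)
  \<comment> \<open>The degree bound \<open>N\<close> stays free: it is \<open>degree p\<close> in
    the proof that the degree is at most \<open>n\<close>, and \<open>n\<close> afterwards.\<close>
  ultimately have *: "(if m < n then b m else 0) =
      (\<Sum>l=Suc m..N. coeff p l * real (l choose m) * (-1) ^ (l - Suc m))" if "degree p \<le> N" for m N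
    using coeff_backward_difference[OF that, of m] by simp
  show deg: "degree p \<le> n"
  proof (rule ccontr)
    assume "\<not> degree p \<le> n"
    then obtain d where d: "degree p = Suc d" "d \<ge> n" by (cases "degree p") auto
    \<comment> \<open>At index \<open>d\<close> the sum has the single term
      \<open>l = Suc d\<close>, a nonzero multiple of the leading coefficient, whereas the
      right-hand polynomial has coefficient 0 there.\<close>
    then have "coeff p (Suc d) = 0" using *[of "Suc d" d] by simp
    then show False using d by (metis leading_coeff_0_iff degree_0 nat.simps(3))
  qed
  show "b m = (\<Sum>l=Suc m..n. coeff p l * real (l choose m) * (-1) ^ (l - Suc m))" if "m < n"
    using *[OF deg, of m] that by simp
qed

section \<open>Polynomiality along diagonals and the coefficient recursion\<close>

lemma St_polynomial: "\<exists>p::real poly. \<forall>k. real (St (k + r) k) = poly p (real k)"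
proof (induction r rule: less_induct)
  case (less r)
  then obtain P :: "nat \<Rightarrow> real poly" where
    P: "\<And>s k. s < r \<Longrightarrow> real (St (k + s) k) = poly (P s) (real k)" by metis
  \<comment> \<open>The summand \<open>i \<ge> 2\<close> lies on the diagonal
    \<open>r + 1 - i < r\<close>, so the induction hypothesis covers it. The index is shifted:
    \<open>q\<close> at \<open>k\<close> is \<open>R(k + 1)\<close>, the increment from
    \<open>k\<close> to \<open>k + 1\<close>.\<close>
  define q where "q = (\<Sum>i=2..r + 1. smult (real (St (i - 1) 0)) (P (r + 1 - i)))"
  obtain Q where Q: "\<And>k. poly Q (real k) = (\<Sum>j<k. poly q (real j))"
    using sum_poly_polynomial by metis
  have step: "real (St (Suc k + r) (Suc k)) = real (St (k + r) k) + poly q (real k)" for k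
  proof -
    have P': "real (St (Suc k + r - i) k) = poly (P (r + 1 - i)) (real k)" if "i \<in> {2..r + 1}" for i
    proof -
      have "k + (r + 1 - i) = Suc k + r - i" using that by auto
      moreover have "real (St (k + (r + 1 - i)) k) = poly (P (r + 1 - i)) (real k)"
        using that by (intro P) auto
      ultimately show ?thesis by (simp only:)
    qed
    have "real (\<Sum>i=2..r + 1. St (Suc k + r - i) k * St (i - 1) 0) = poly q (real k)"
      unfolding q_def poly_sum of_nat_sum
      by (rule sum.cong[OF refl]) (simp only: of_nat_mult poly_smult P' mult.commute)
    then show ?thesis unfolding St_add_Suc by simp
  qed
  \<comment> \<open>The starting value at \<open>k = 0\<close> is \<open>St r 0\<close>;
    \<open>Q\<close> adds up the increments.\<close>
  have "real (St (k + r) k) = poly ([:real (St r 0):] + Q) (real k)" for k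
  proof (induction k)
    case 0
    then show ?case by (simp add: Q[of 0, simplified])
  next
    case (Suc k)
    then show ?case using step[of k] Q[of k] Q[of "Suc k"] by simp
  qed
  then show ?case by blast
qed

text \<open>Since \<open>b\<close> may end in zeros, the degree is exactly \<open>n\<close> under
  \<open>b (n - 1) \<noteq> 0\<close> and at most \<open>n\<close> in general.\<close>

theorem theorem10:
  fixes r :: nat
  shows "\<exists>p :: real poly.
    (\<forall>k. real (St (k + r) k) = poly p (real k)) \<and>
    (\<forall>(n::nat) (b :: nat \<Rightarrow> real).
       n \<ge> 1 \<longrightarrow>
       (\<forall>k\<ge>1. real (\<Sum>i=2..r+1. St ((k + r) - i) (k - 1) * St (i - 1) 0)
                 = (\<Sum>m=0..n-1. b m * real k ^ m)) \<longrightarrow>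
       degree p \<le> n \<and>
       (b (n - 1) \<noteq> 0 \<longrightarrow> degree p = n) \<and>
       coeff p n = b (n - 1) / real n \<and>
       (\<forall>j. 1 \<le> j \<and> j \<le> n - 1 \<longrightarrow>
          coeff p (n - j) =
            (b (n - j - 1)
              - (\<Sum>i=0..j-1. (-1) ^ (j - i) * real ((n - i) choose (j + 1 - i)) * coeff p (n - i)))
            / real ((n - j) choose 1)) \<and>
       coeff p 0 = real (St r 0))"
proof -
  obtain p :: "real poly" where p: "\<And>k. real (St (k + r) k) = poly p (real k)"
    using St_polynomial by blast
  \<comment> \<open>The backward difference forgets the constant coefficient, so it is read off at
    \<open>k = 0\<close>.\<close>
  have p0: "coeff p 0 = real (St r 0)"
    using p[of 0] by (simp add: poly_0_coeff_0)
  have rest: "degree p \<le> n \<and> (b (n - 1) \<noteq> 0 \<longrightarrow> degree p = n) \<and> coeff p n = b (n - 1) / real n \<and>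
      (\<forall>j. 1 \<le> j \<and> j \<le> n - 1 \<longrightarrow> coeff p (n - j) =
        (b (n - j - 1)
          - (\<Sum>i=0..j-1. (-1) ^ (j - i) * real ((n - i) choose (j + 1 - i)) * coeff p (n - i)))
        / real ((n - j) choose 1))"
    if n: "n \<ge> 1" and R: "\<forall>k\<ge>1. real (\<Sum>i=2..r+1. St ((k + r) - i) (k - 1) * St (i - 1) 0)
        = (\<Sum>m=0..n-1. b m * real k ^ m)" for n and b :: "nat \<Rightarrow> real"
  proof -
    have "poly p (real k) - poly p (real k - 1) = (\<Sum>m=0..n - 1. b m * real k ^ m)" if k: "k \<ge> 1" for k
    proof -
      obtain k' where k': "k = Suc k'" using k by (cases k) auto
      have "real (St (k + r) k) = real (St (k' + r) k')
          + real (\<Sum>i=2..r+1. St ((k + r) - i) (k - 1) * St (i - 1) 0)"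
        unfolding k' St_add_Suc by simp
      moreover have "real k - 1 = real k'" using k' by simp
      ultimately show ?thesis using R k p[of k] p[of k'] by simp
    qed
    note bd = backward_difference_coeffs[OF n this]
    \<comment> \<open>At index \<open>n - 1\<close> only \<open>l = n\<close> contributes, with
      binomial coefficient \<open>n\<close>.\<close>
    have top: "b (n - 1) = real n * coeff p n"
      using bd(2)[of "n - 1"] n binomial_symmetric[of 1 n] by (simp add: mult.commute)
    have "coeff p (n - j) =
        (b (n - j - 1)
          - (\<Sum>i=0..j-1. (-1) ^ (j - i) * real ((n - i) choose (j + 1 - i)) * coeff p (n - i)))
        / real ((n - j) choose 1)" if j: "1 \<le> j" "j \<le> n - 1" for j
    proof -
      let ?f = "\<lambda>i. (-1) ^ (j - i) * real ((n - i) choose (j + 1 - i)) * coeff p (n - i)"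
      have "b (n - j - 1) = (\<Sum>l=n - j..n. coeff p l * real (l choose (n - j - 1)) * (-1) ^ (l - (n - j)))"
        using bd(2)[of "n - j - 1"] j n by (simp add: Suc_diff_Suc)
      also have "\<dots> = (\<Sum>i=0..j. ?f i)"
      \<comment> \<open>Substituting \<open>l = n - i\<close> and using the symmetry of binomial
        coefficients turns the comparison at index \<open>n - j - 1\<close> into the form of the
        recursion.\<close>
      proof (rule sum.reindex_bij_witness[of _ "\<lambda>i. n - i" "\<lambda>l. n - l"])
        fix l assume l: "l \<in> {n - j..n}"
        have "l choose (n - j - 1) = l choose (j + 1 - (n - l))"
        proof -
          have "n - j - 1 \<le> l" "l - (n - j - 1) = j + 1 - (n - l)" using l j by auto
          then show ?thesis using binomial_symmetric[of "n - j - 1" l] by simp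
        qed
        moreover have "j - (n - l) = l - (n - j)" using l j by auto
        ultimately show "?f (n - l) = coeff p l * real (l choose (n - j - 1)) * (-1) ^ (l - (n - j))"
          using l by simp
      qed (use j in auto)
      \<comment> \<open>The term \<open>i = j\<close> has sign +1 and carries the unknown
        \<open>coeff p (n - j)\<close>; its factor \<open>n - j\<close> is nonzero because
        \<open>j \<le> n - 1\<close>.\<close>
      also have "\<dots> = (\<Sum>i=0..j-1. ?f i) + real ((n - j) choose 1) * coeff p (n - j)"
        using j by (cases j) auto
      finally show ?thesis using j by (simp add: field_simps)
    qed
    moreover have "degree p = n" if "b (n - 1) \<noteq> 0"
      using that top bd(1) by (intro antisym le_degree) auto
    moreover have "coeff p n = b (n - 1) / real n"
      using top n by simp
    ultimately show ?thesis using bd(1) by blast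
  qed
  show ?thesis
    using p p0 rest by (intro exI[of _ p] conjI allI impI) blast+
qed

end
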